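(* Let $v : 2^{\mathcal{C}} \to \mathbb{R}$ be the college application portfolio valuation function $v(\mathcal{X}) = \operatorname{E}\bigl[\max\{t_0, \max\{t_j Z_j : j\in\mathcal{X}\}\}\bigr]$, where $\mathcal{C}=\{1,\dots,m\}$, $0\le t_0 < t_1 \le \cdots \le t_m$, and $Z_1,\dots,Z_m$ are independent Bernoulli random variables with success probabilities $f_1,\dots,f_m\in(0,1]$. Then $v$ is a nondecreasing submodular set function.
   Context: For $\mathcal{X}=\varnothing$ one has $v(\varnothing)=t_0$. A set function $v:2^{\mathcal{C}}\to\mathbb{R}$ is submodular if $v(\mathcal{X})+v(\mathcal{Y})\ge v(\mathcal{X}\cup\mathcal{Y})+v(\mathcal{X}\cap\mathcal{Y})$ for all $\mathcal{X},\mathcal{Y}\subseteq\mathcal{C}$. It is a nondecreasing submodular set function if, in addition, $v(\mathcal{X}\cup\{k\})-v(\mathcal{X})\ge 0$ for all $\mathcal{X}\subset\mathcal{C}$ and $k\in\mathcal{C}\setminus\mathcal{X}$. *)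

theory Defs
  imports "HOL-Probability.Probability"
begin

definition submodular_on :: "'a set \<Rightarrow> ('a set \<Rightarrow> real) \<Rightarrow> bool" where
  "submodular_on C v \<longleftrightarrow>
     (\<forall>X Y. X \<subseteq> C \<longrightarrow> Y \<subseteq> C \<longrightarrow> v X + v Y \<ge> v (X \<union> Y) + v (X \<inter> Y))"

definition nondecreasing_submodular_on :: "'a set \<Rightarrow> ('a set \<Rightarrow> real) \<Rightarrow> bool" where
  "nondecreasing_submodular_on C v \<longleftrightarrow>
     submodular_on C v \<and>
     (\<forall>X k. X \<subset> C \<longrightarrow> k \<in> C - X \<longrightarrow> v (X \<union> {k}) - v X \<ge> 0)"

text \<open>A real-valued random variable is Bernoulli if its law is the image of the boolean
  distribution \<^const>\<open>bernoulli_pmf\<close> under the embedding of the booleans as 0 and 1.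
  It takes values in {0, 1} almost surely, but possibly not everywhere.\<close>

definition (in prob_space) bernoulli_rv :: "real \<Rightarrow> ('a \<Rightarrow> real) \<Rightarrow> bool" where
  "bernoulli_rv p Z \<longleftrightarrow>
     random_variable borel Z \<and>
     distr M borel Z = distr (measure_pmf (bernoulli_pmf p)) borel of_bool"

text \<open>Inserting \<open>t 0\<close> into the set, rather than nesting \<^const>\<open>max\<close> and \<^const>\<open>Max\<close>, avoids the
  unspecified maximum of the empty set; \<open>X\<close> is meant to be finite.\<close>

definition (in prob_space) portfolio_value ::
    "(nat \<Rightarrow> real) \<Rightarrow> (nat \<Rightarrow> 'a \<Rightarrow> real) \<Rightarrow> nat set \<Rightarrow> real" where
  "portfolio_value t Z X =
     expectation (\<lambda>\<omega>. Max (insert (t 0) ((\<lambda>j. t j * Z j \<omega>) ` X)))"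

lemma (in prob_space) portfolio_value_empty: "portfolio_value t Z {} = t 0"
  by (simp add: portfolio_value_def prob_space)

lemma (in prob_space) portfolio_value_nonempty:
  assumes "finite X" "X \<noteq> {}"
  shows "portfolio_value t Z X =
    expectation (\<lambda>\<omega>. max (t 0) (Max {t j * Z j \<omega> | j. j \<in> X}))"
  using assms by (simp add: portfolio_value_def Setcompr_eq_image)

end

theory Submission
  imports Defs
begin

text \<open>Pointwise in the sample space, the largest value on \<open>X \<union> Y\<close> is attained on \<open>X\<close> or on \<open>Y\<close>,
  and the largest value on \<open>X \<inter> Y\<close> is at most the smaller of the two maxima. So the maximum of
  finitely many reals is monotone and submodular in the index set, and both properties
  pass to expectations once the maxima are integrable.\<close>

lemma Max_insert_image_submodular:
  fixes g :: "'i \<Rightarrow> real"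
  assumes "finite X" "finite Y"
  shows "Max (insert c (g ` (X \<union> Y))) + Max (insert c (g ` (X \<inter> Y)))
    \<le> Max (insert c (g ` X)) + Max (insert c (g ` Y))"
proof -
  let ?A = "insert c (g ` X)" and ?B = "insert c (g ` Y)" and ?I = "insert c (g ` (X \<inter> Y))"
  have "insert c (g ` (X \<union> Y)) = ?A \<union> ?B" by auto
  then have "Max (insert c (g ` (X \<union> Y))) = max (Max ?A) (Max ?B)"
    using assms by (simp only:) (rule Max_Un; simp)
  moreover have "Max ?I \<le> Max ?A" "Max ?I \<le> Max ?B"
    using assms by (intro Max_mono; auto)+
  \<comment> \<open>The maximum on the union equals one of the maxima of \<open>?A\<close> and
    \<open>?B\<close>, and the maximum of \<open>?I\<close> is bounded by the other one.\<close>
  ultimately show ?thesis by linarith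
qed

text \<open>Binary \<open>max\<close> preserves integrability, so induction on the index set
  suffices. The base value \<open>c\<close> keeps the set nonempty, so that every new index splits
  off as a binary \<open>max\<close>.\<close>

lemma integrable_Max_insert_image:
  fixes g :: "'i \<Rightarrow> 'a \<Rightarrow> real"
  assumes "finite X" "integrable M c" "\<And>j. j \<in> X \<Longrightarrow> integrable M (g j)"
  shows "integrable M (\<lambda>\<omega>. Max (insert (c \<omega>) ((\<lambda>j. g j \<omega>) ` X)))"
  using assms(1,3)
proof (induction X rule: finite_induct)
  case empty
  then show ?case using assms(2) by simp
next
  case (insert k X)
  have "Max (insert (c \<omega>) ((\<lambda>j. g j \<omega>) ` insert k X))
      = max (g k \<omega>) (Max (insert (c \<omega>) ((\<lambda>j. g j \<omega>) ` X)))" for \<omega>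
    using Max_insert[of "insert (c \<omega>) ((\<lambda>j. g j \<omega>) ` X)" "g k \<omega>"] insert.hyps(1)
    by (simp add: insert_commute del: Max_insert)
  then show ?case
    using insert by (simp add: integrable_max del: Max_insert)
qed

text \<open>\<open>Z\<close> may be unbounded on a null set, so integrability is read off from its
  law, the image of a distribution on the finite type \<open>bool\<close>.\<close>

lemma (in prob_space) integrable_bernoulli_rv:
  assumes "bernoulli_rv p Z"
  shows "integrable M Z"
proof -
  have Z: "Z \<in> borel_measurable M"
    and law: "distr M borel Z = distr (measure_pmf (bernoulli_pmf p)) borel of_bool"
    using assms by (auto simp: bernoulli_rv_def)
  have "integrable (measure_pmf (bernoulli_pmf p)) (of_bool :: bool \<Rightarrow> real)"
    by (rule integrable_measure_pmf_finite) (rule finite)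
  then have "integrable (distr M borel Z) (\<lambda>x. x)"
    unfolding law by (simp add: integrable_distr_eq)
  then show ?thesis
    using Z by (simp add: integrable_distr_eq)
qed

theorem theorem1:
  fixes M :: "'a measure" and m :: nat and t f :: "nat \<Rightarrow> real"
    and Z :: "nat \<Rightarrow> 'a \<Rightarrow> real"
  assumes "prob_space M"
    and "0 \<le> t 0"
    and "1 \<le> m \<Longrightarrow> t 0 < t 1"
    and "\<And>j. 1 \<le> j \<Longrightarrow> j < m \<Longrightarrow> t j \<le> t (j + 1)"
    and "\<And>j. j \<in> {1..m} \<Longrightarrow> f j \<in> {0<..1}"
    and "\<And>j. j \<in> {1..m} \<Longrightarrow> prob_space.bernoulli_rv M (f j) (Z j)"
    and "prob_space.indep_vars M (\<lambda>_. borel) Z {1..m}"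
  shows "nondecreasing_submodular_on {1..m} (prob_space.portfolio_value M t Z)"
proof -
  interpret prob_space M by fact
  \<comment> \<open>The Bochner integral is 0 on non-integrable functions, so additivity and
    monotonicity of the expectation rest on this fact.\<close>
  have int: "integrable M (\<lambda>\<omega>. Max (insert (t 0) ((\<lambda>j. t j * Z j \<omega>) ` X)))"
    if "X \<subseteq> {1..m}" for X
  proof (intro integrable_Max_insert_image integrable_const)
    show "finite X" using that by (rule finite_subset) simp
    show "integrable M (\<lambda>\<omega>. t j * Z j \<omega>)" if "j \<in> X" for j
      using that \<open>X \<subseteq> {1..m}\<close>
      by (intro integrable_mult_right integrable_bernoulli_rv[of "f j"] assms(6)) auto
  qed
  show ?thesis
    unfolding nondecreasing_submodular_on_def submodular_on_def
  proof (intro conjI allI impI)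
    fix X Y :: "nat set"
    assume sub: "X \<subseteq> {1..m}" "Y \<subseteq> {1..m}"
    then have fin: "finite X" "finite Y"
      by (auto intro: finite_subset)
    have "X \<union> Y \<subseteq> {1..m}" "X \<inter> Y \<subseteq> {1..m}" using sub by auto
    note ints = this[THEN int] sub[THEN int]
    show "portfolio_value t Z (X \<union> Y) + portfolio_value t Z (X \<inter> Y)
        \<le> portfolio_value t Z X + portfolio_value t Z Y"
      \<comment> \<open>Each side is merged into the expectation of a sum, which reduces the goal to
        the pointwise inequality.\<close>
      unfolding portfolio_value_def
        Bochner_Integration.integral_add[OF ints(1,2), symmetric]
        Bochner_Integration.integral_add[OF ints(3,4), symmetric]
      using ints fin
      by (intro integral_mono Bochner_Integration.integrable_add Max_insert_image_submodular)
  next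
    fix X :: "nat set" and k
    assume "X \<subset> {1..m}" "k \<in> {1..m} - X"
    then have sub: "X \<subseteq> {1..m}" "X \<union> {k} \<subseteq> {1..m}" by auto
    then have "finite X" by (auto intro: finite_subset)
    \<comment> \<open>Pointwise, a maximum grows with its set; \<open>t 0\<close> covers the case of
      empty \<open>X\<close>.\<close>
    then have "portfolio_value t Z X \<le> portfolio_value t Z (X \<union> {k})"
      unfolding portfolio_value_def
      by (intro integral_mono sub[THEN int] Max_mono) auto
    then show "0 \<le> portfolio_value t Z (X \<union> {k}) - portfolio_value t Z X" by simp
  qed
qed

end
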